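(* Let $(C,\phi,F)$ be a semicoherent $n$-component system with $C=\{1,\ldots,n\}$ whose component lifetimes $T_1,\ldots,T_n$ have no ties, and let $(M,\chi)$ be a module of the system with organizing structure $\psi$ and $m=|M|$. Assume that $$ \frac{q_j(A\cup B)}{q_j^M(A)} = \frac{q_{j'}(A'\cup B)}{q_{j'}^M(A')} $$ for any $j,j'\in M$, any $A\subseteq M\setminus\{j\}$ and $A'\subseteq M\setminus\{j'\}$ such that $|A|=|A'|$, $q_j^M(A)\neq 0$ and $q_{j'}^M(A')\neq 0$, and any $B\subseteq C\setminus M$. Then, for any $k\in\{1,\ldots,m\}$, any $j\in M$, and any $A\subseteq M\setminus\{j\}$ such that $|A|=m-k$ and $q_j^M(A)\neq 0$, we have $$ p_M^{(k)} = p_k^M\,\sum_{B\subseteq C\setminus M}\frac{q_j(A\cup B)}{q_j^M(A)}\,\Delta_{[M]}\psi(B), $$ where $p_M^{(k)}=\Pr(T_C=T_{k:M})$ and $p_k^M=\Pr(T_M=T_{k:M})$, and where the coefficient of $\Delta_{[M]}\psi(B)$ is the conditional probability $$ \frac{q_j(A\cup B)}{q_j^M(A)} = \Pr\Big(\max_{i\in (C\setminus M)\setminus B}T_i<T_j<\min_{i\in B}T_i\ \Big|\ \max_{i\in M\setminus A}T_i=T_j<\min_{i\in A} T_i\Big). $$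
   Context: $C=\{1,\ldots,n\}$ is the set of components. $T_1,\ldots,T_n$ are nonnegative real random variables on a common probability space (the component lifetimes), with joint c.d.f. $F$, and there are no ties: $\Pr(T_i=T_j)=0$ for all distinct $i,j\in C$. Structure functions $\{0,1\}^S\to\{0,1\}$ are identified with set functions $2^S\to\{0,1\}$ (identify $\mathbf{x}$ with $\{i\in S: x_i=1\}$). A structure function is semicoherent if it is nondecreasing in each variable, takes value $0$ at $\varnothing$ and value $1$ at the full set; $\phi\colon\{0,1\}^C\to\{0,1\}$ is assumed semicoherent. Module: $M\subseteq C$ is nonempty, $[M]$ denotes a single macro-component replacing $M$, $C_M=(C\setminus M)\cup\{[M]\}$, and $\chi\colon\{0,1\}^M\to\{0,1\}$, $\psi\colon\{0,1\}^{C_M}\to\{0,1\}$ are semicoherent structure functions such that $\phi(\mathbf{x})=\psi\big(\chi(\mathbf{x}^M),\mathbf{x}^{C\setminus M}\big)$ for all $\mathbf{x}\in\{0,1\}^C$, where $\mathbf{x}^M=(x_i)_{i\in M}$, $\mathbf{x}^{C\setminus M}=(x_i)_{i\in C\setminus M}$, and $\chi(\mathbf{x}^M)$ is the value of the $[M]$-variable of $\psi$. For $B\subseteq C\setminus M$, $\Delta_{[M]}\psi(B)=\psi(B\cup\{[M]\})-\psi(B)$. Lifetimes: $T_C=\max_{A\subseteq C,\ \phi(A)=1}\min_{i\in A}T_i$ (system) and $T_M=\max_{A\subseteq M,\ \chi(A)=1}\min_{i\in A}T_i$ (module). $T_{k:M}$ is the $k$th smallest of the variables $T_i$, $i\in M$.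 For $j\in C$, $A\subseteq C\setminus\{j\}$: $q_j(A)=\Pr\big(\max_{i\in C\setminus A}T_i=T_j<\min_{i\in A}T_i\big)$. For $j\in M$, $A\subseteq M\setminus\{j\}$: $q_j^M(A)=\Pr\big(\max_{i\in M\setminus A}T_i=T_j<\min_{i\in A}T_i\big)$. The minimum over the empty set is $+\infty$ and the maximum over the empty set is $-\infty$. *)

theory Defs
  imports "HOL-Probability.Probability"
begin

text \<open>
  Structure functions on a component set \<open>S\<close> are real-valued set functions, of which only the
  values on subsets of \<open>S\<close> matter; a subset stands for its 0-1 indicator vector.
\<close>

definition semicoherent :: "'i set \<Rightarrow> ('i set \<Rightarrow> real) \<Rightarrow> bool" where
  "semicoherent S \<phi> \<longleftrightarrow>
     \<phi> \<in> Pow S \<rightarrow> {0, 1} \<and>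
     (\<forall>i\<in>S. \<forall>A. A \<subseteq> S - {i} \<longrightarrow> \<phi> A \<le> \<phi> (insert i A)) \<and>
     \<phi> {} = 0 \<and> \<phi> S = 1"

text \<open>
  In the reduced system, \<open>None\<close> is the macro-component \<open>[M]\<close> and \<open>Some i\<close> is
  the original component \<open>i\<close>.
\<close>

definition reduced_components :: "'i set \<Rightarrow> 'i set \<Rightarrow> 'i option set" where
  "reduced_components C M = insert None (Some ` (C - M))"

definition system_module ::
  "'i set \<Rightarrow> ('i set \<Rightarrow> real) \<Rightarrow> 'i set \<Rightarrow> ('i set \<Rightarrow> real) \<Rightarrow> ('i option set \<Rightarrow> real) \<Rightarrow> bool" where
  "system_module C \<phi> M \<chi>\<^sub>M \<psi> \<longleftrightarrow>
     M \<noteq> {} \<and> M \<subseteq> C \<and> semicoherent M \<chi>\<^sub>M \<and> semicoherent (reduced_components C M) \<psi> \<and>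
     (\<forall>X. X \<subseteq> C \<longrightarrow>
        \<phi> X = \<psi> ((if \<chi>\<^sub>M (X \<inter> M) = 1 then {None} else {}) \<union> Some ` (X - M)))"

text \<open>\<open>macro_delta \<psi> B\<close> is \<open>\<Delta>\<close> of \<open>\<psi>\<close> in the \<open>[M]\<close>-variable at \<open>B\<close>.\<close>

definition macro_delta :: "('i option set \<Rightarrow> real) \<Rightarrow> 'i set \<Rightarrow> real" where
  "macro_delta \<psi> B = \<psi> (insert None (Some ` B)) - \<psi> (Some ` B)"

text \<open>
  For semicoherent \<open>\<phi>\<close> on a finite \<open>S\<close>, both extrema below range over finite nonempty sets,
  because \<open>\<phi> {} = 0\<close> and \<open>\<phi> S = 1\<close>.
\<close>

definition lifetime :: "'i set \<Rightarrow> ('i set \<Rightarrow> real) \<Rightarrow> ('i \<Rightarrow> 'w \<Rightarrow> real) \<Rightarrow> 'w \<Rightarrow> real" where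
  "lifetime S \<phi> T \<omega> = Max ((\<lambda>A. Min ((\<lambda>i. T i \<omega>) ` A)) ` {A. A \<subseteq> S \<and> \<phi> A = 1})"

text \<open>The \<open>k\<close>th smallest value, counted with multiplicity; meaningful for \<open>1 \<le> k \<le> card S\<close>.\<close>

definition order_stat :: "'i set \<Rightarrow> ('i \<Rightarrow> 'w \<Rightarrow> real) \<Rightarrow> nat \<Rightarrow> 'w \<Rightarrow> real" where
  "order_stat S T k \<omega> =
     sorted_list_of_multiset (image_mset (\<lambda>i. T i \<omega>) (mset_set S)) ! (k - 1)"

text \<open>
  Maxima and minima over possibly empty finite sets are taken in the extended reals, where
  \<open>Sup {} = -\<infinity>\<close> and \<open>Inf {} = \<infinity>\<close>.
\<close>

definition max_life :: "'i set \<Rightarrow> ('i \<Rightarrow> 'w \<Rightarrow> real) \<Rightarrow> 'w \<Rightarrow> ereal" where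
  "max_life A T \<omega> = (SUP i\<in>A. ereal (T i \<omega>))"

definition min_life :: "'i set \<Rightarrow> ('i \<Rightarrow> 'w \<Rightarrow> real) \<Rightarrow> 'w \<Rightarrow> ereal" where
  "min_life A T \<omega> = (INF i\<in>A. ereal (T i \<omega>))"

definition rel_quality ::
  "'w measure \<Rightarrow> ('i \<Rightarrow> 'w \<Rightarrow> real) \<Rightarrow> 'i set \<Rightarrow> 'i \<Rightarrow> 'i set \<Rightarrow> real" where
  "rel_quality P T S j A =
     \<P>(\<omega> in P. max_life (S - A) T \<omega> = ereal (T j \<omega>) \<and> ereal (T j \<omega>) < min_life A T \<omega>)"

end

theory Submission
  imports Defs
begin

text \<open>
  The event behind \<open>q\<^sub>j(A)\<close> says that \<open>A\<close> is exactly the set of components that outlive \<open>j\<close>.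
  If the lifetimes are distinct, a system with structure function \<open>\<phi>\<close> dies together with \<open>j\<close> iff
  \<open>j\<close> is critical at that moment, that is, iff \<open>\<phi>\<close> drops from 1 to 0 when \<open>j\<close> is removed from
  \<open>insert j A\<close>; and \<open>j\<close> is the \<open>k\<close>th failure inside \<open>M\<close> iff \<open>m - k\<close> components of \<open>M\<close>
  outlive it. Summing over all \<open>j\<close> and \<open>A\<close> gives, for every system on \<open>S \<supseteq> M\<close>
  (lemma \<open>prob_lifetime_eq_order_stat\<close>),
  \[ \Pr(T_S = T_{k:M}) = \sum_{j \in M}\ \sum_{A \subseteq S - j,\ |A \cap M| = m-k}
       q_j(A)\,(\phi(A \cup j) - \phi(A)). \]

  The formula is used twice, with \<open>S = M\<close> for the module and with \<open>S = C\<close> for the system. In the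
  second case the index splits as \<open>A \<union> B\<close> with \<open>A \<subseteq> M\<close> and \<open>B \<subseteq> C - M\<close>, and the modular form
  of \<open>\<phi>\<close> makes the marginal difference factor into that of \<open>\<chi>\<close> at \<open>A\<close> times
  \<open>\<Delta>\<psi>(B)\<close>. Pulling \<open>q\<^sub>j\<^sup>M(A)\<close> out of \<open>q\<^sub>j(A \<union> B)\<close> leaves an inner sum over \<open>B\<close> which, by
  the hypothesis on the ratios, is the same for all \<open>j\<close> and all \<open>A\<close> of size \<open>m - k\<close>; terms with
  \<open>q\<^sub>j\<^sup>M(A) = 0\<close> vanish because then \<open>q\<^sub>j(A \<union> B) = 0\<close> as well. What remains outside is the
  formula for the module.

  For the conditional probability, the conjunction of the two events differs from the event of
  \<open>q\<^sub>j(A \<union> B)\<close> only by outcomes with a tie.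
\<close>

section \<open>Lifetimes of monotone structures\<close>

lemma semicoherent_mono:
  assumes "semicoherent S \<phi>" "finite S" "B \<subseteq> S" "A \<subseteq> B"
  shows "\<phi> A \<le> \<phi> B"
proof -
  have "A \<union> D \<subseteq> S \<longrightarrow> \<phi> A \<le> \<phi> (A \<union> D)" if "finite D" for D
    using that
  proof induction
    case (insert x D)
    have "\<phi> (A \<union> D) \<le> \<phi> (insert x (A \<union> D))" if "insert x (A \<union> D) \<subseteq> S"
    proof (cases "x \<in> A \<union> D")
      case True
      then show ?thesis by (simp add: insert_absorb)
    next
      case False
      then show ?thesis using assms(1) that unfolding semicoherent_def by blast
    qed
    then show ?case using insert.IH by auto
  qed simp
  moreover have "A \<union> B = B" "finite B" using assms finite_subset by auto
  ultimately show ?thesis using assms(3) by metis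
qed

lemma semicoherent_cases:
  assumes "semicoherent S \<phi>" "A \<subseteq> S"
  shows "\<phi> A = 0 \<or> \<phi> A = 1"
  using assms unfolding semicoherent_def by auto

text \<open>
  The system is still working at a time iff the components working at that time form a
  working state. Both versions are needed: \<open>T\<^sub>C = t\<close> means that the system works at \<open>t\<close> but not
  after \<open>t\<close>.
\<close>

lemma lifetime_ge_and_gt_iff:
  assumes sc: "semicoherent S \<phi>" and fin: "finite S"
  shows lifetime_ge_iff: "t \<le> lifetime S \<phi> T \<omega> \<longleftrightarrow> \<phi> {i\<in>S. t \<le> T i \<omega>} = 1"
    and lifetime_gt_iff: "t < lifetime S \<phi> T \<omega> \<longleftrightarrow> \<phi> {i\<in>S. t < T i \<omega>} = 1"
proof -
  let ?W = "{A. A \<subseteq> S \<and> \<phi> A = 1}"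
  have W: "finite ?W" "?W \<noteq> {}"
    using fin sc by (auto simp: semicoherent_def)
  have ne: "finite A" "A \<noteq> {}" if "A \<in> ?W" for A
    using that sc fin by (auto simp: semicoherent_def intro: finite_subset)
  have up: "\<phi> B = 1" if "A \<in> ?W" "A \<subseteq> B" "B \<subseteq> S" for A B
    using semicoherent_mono[OF sc fin that(3,2)] semicoherent_cases[OF sc that(3)] that(1) by auto
  have "t \<le> lifetime S \<phi> T \<omega> \<longleftrightarrow> (\<exists>A\<in>?W. \<forall>i\<in>A. t \<le> T i \<omega>)"
    unfolding lifetime_def using W ne by (subst Max_ge_iff) auto
  also have "\<dots> \<longleftrightarrow> \<phi> {i\<in>S. t \<le> T i \<omega>} = 1"
  proof
    assume "\<exists>A\<in>?W. \<forall>i\<in>A. t \<le> T i \<omega>"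
    then obtain A where "A \<in> ?W" "\<forall>i\<in>A. t \<le> T i \<omega>" by blast
    then show "\<phi> {i\<in>S. t \<le> T i \<omega>} = 1" by (intro up[of A]) auto
  next
    assume "\<phi> {i\<in>S. t \<le> T i \<omega>} = 1"
    then show "\<exists>A\<in>?W. \<forall>i\<in>A. t \<le> T i \<omega>"
      by (intro bexI[of _ "{i\<in>S. t \<le> T i \<omega>}"]) auto
  qed
  finally show "t \<le> lifetime S \<phi> T \<omega> \<longleftrightarrow> \<phi> {i\<in>S. t \<le> T i \<omega>} = 1" .
  have "t < lifetime S \<phi> T \<omega> \<longleftrightarrow> (\<exists>A\<in>?W. \<forall>i\<in>A. t < T i \<omega>)"
    unfolding lifetime_def using W ne by (subst Max_gr_iff) auto
  also have "\<dots> \<longleftrightarrow> \<phi> {i\<in>S. t < T i \<omega>} = 1"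
  proof
    assume "\<exists>A\<in>?W. \<forall>i\<in>A. t < T i \<omega>"
    then obtain A where "A \<in> ?W" "\<forall>i\<in>A. t < T i \<omega>" by blast
    then show "\<phi> {i\<in>S. t < T i \<omega>} = 1" by (intro up[of A]) auto
  next
    assume "\<phi> {i\<in>S. t < T i \<omega>} = 1"
    then show "\<exists>A\<in>?W. \<forall>i\<in>A. t < T i \<omega>"
      by (intro bexI[of _ "{i\<in>S. t < T i \<omega>}"]) auto
  qed
  finally show "t < lifetime S \<phi> T \<omega> \<longleftrightarrow> \<phi> {i\<in>S. t < T i \<omega>} = 1" .
qed

definition outliving :: "'i set \<Rightarrow> ('i \<Rightarrow> 'w \<Rightarrow> real) \<Rightarrow> 'i \<Rightarrow> 'w \<Rightarrow> 'i set" where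
  "outliving S T j \<omega> = {i\<in>S. T j \<omega> < T i \<omega>}"

lemma lifetime_eq_component_iff:
  assumes sc: "semicoherent S \<phi>" and fin: "finite S" and inj: "inj_on (\<lambda>i. T i \<omega>) S"
    and j: "j \<in> S"
  shows "lifetime S \<phi> T \<omega> = T j \<omega> \<longleftrightarrow>
    \<phi> (insert j (outliving S T j \<omega>)) = 1 \<and> \<phi> (outliving S T j \<omega>) = 0"
proof -
  have "{i\<in>S. T j \<omega> \<le> T i \<omega>} = insert j (outliving S T j \<omega>)"
    using inj j by (auto simp: outliving_def le_less inj_on_def)
  moreover have "\<phi> (outliving S T j \<omega>) \<noteq> 1 \<longleftrightarrow> \<phi> (outliving S T j \<omega>) = 0"
    using semicoherent_cases[OF sc, of "outliving S T j \<omega>"] by (auto simp: outliving_def)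
  ultimately show ?thesis
    using lifetime_ge_iff[OF sc fin, of "T j \<omega>" T \<omega>] lifetime_gt_iff[OF sc fin, of "T j \<omega>" T \<omega>]
    by (auto simp: outliving_def)
qed

section \<open>Order statistics as system lifetimes\<close>

text \<open>The system that fails at the \<open>k\<close>th component failure (\<open>k\<close>-out-of-\<open>n\<close>:F).\<close>

definition k_out_of_n :: "'i set \<Rightarrow> nat \<Rightarrow> 'i set \<Rightarrow> real" where
  "k_out_of_n S k A = (if card S - k < card A then 1 else 0)"

lemma semicoherent_k_out_of_n:
  assumes "finite S" "k \<in> {1..card S}"
  shows "semicoherent S (k_out_of_n S k)"
proof -
  have "k_out_of_n S k A \<le> k_out_of_n S k (insert i A)" if "A \<subseteq> S - {i}" for i A
  proof -
    have "finite A" using that assms by (meson finite_Diff finite_subset)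
    then have "card A \<le> card (insert i A)" by (simp add: card_insert_le)
    then show ?thesis by (simp add: k_out_of_n_def)
  qed
  moreover have "k_out_of_n S k A \<in> {0, 1}" for A
    by (simp add: k_out_of_n_def)
  moreover have "k_out_of_n S k {} = 0" "k_out_of_n S k S = 1"
    using assms(2) by (auto simp: k_out_of_n_def)
  ultimately show ?thesis by (auto simp: semicoherent_def)
qed

lemma sorted_nth_ge_iff_length_filter:
  fixes xs :: "'a :: linorder list"
  assumes "sorted xs" "p < length xs"
  shows "t \<le> xs ! p \<longleftrightarrow> length xs - p \<le> length (filter (\<lambda>x. t \<le> x) xs)"
proof
  assume t: "t \<le> xs ! p"
  have "t \<le> x" if x: "x \<in> set (drop p xs)" for x
  proof -
    obtain i where "i < length (drop p xs)" "drop p xs ! i = x"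
      using x unfolding in_set_conv_nth by blast
    then have "xs ! p \<le> x" using sorted_nth_mono[OF assms(1), of p "p + i"] assms(2) by auto
    then show ?thesis using t by simp
  qed
  then have "filter (\<lambda>x. t \<le> x) (drop p xs) = drop p xs" by (simp add: filter_id_conv)
  moreover have "filter (\<lambda>x. t \<le> x) xs =
      filter (\<lambda>x. t \<le> x) (take p xs) @ filter (\<lambda>x. t \<le> x) (drop p xs)"
    by (metis append_take_drop_id filter_append)
  ultimately show "length xs - p \<le> length (filter (\<lambda>x. t \<le> x) xs)" by simp
next
  assume len: "length xs - p \<le> length (filter (\<lambda>x. t \<le> x) xs)"
  show "t \<le> xs ! p"
  proof (rule ccontr)
    assume t: "\<not> t \<le> xs ! p"
    have "x < t" if x: "x \<in> set (take (Suc p) xs)" for x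
    proof -
      obtain i where "i < length (take (Suc p) xs)" "take (Suc p) xs ! i = x"
        using x unfolding in_set_conv_nth by blast
      then have "x \<le> xs ! p" using sorted_nth_mono[OF assms(1), of i p] assms(2) by auto
      then show ?thesis using t by simp
    qed
    then have "filter (\<lambda>x. t \<le> x) (take (Suc p) xs) = []" by (auto simp: filter_empty_conv not_le)
    moreover have "filter (\<lambda>x. t \<le> x) xs =
        filter (\<lambda>x. t \<le> x) (take (Suc p) xs) @ filter (\<lambda>x. t \<le> x) (drop (Suc p) xs)"
      by (metis append_take_drop_id filter_append)
    ultimately have "length (filter (\<lambda>x. t \<le> x) xs) \<le> length xs - Suc p"
      by (metis append_Nil length_drop length_filter_le)
    then show False using len assms(2) by linarith
  qed
qed

text \<open>
  The \<open>k\<close>th smallest of \<open>n\<close> values is at least \<open>t\<close> iff more than \<open>n - k\<close> of them are, and the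
  lifetime of the \<open>k\<close>-out-of-\<open>n\<close> system satisfies the same criterion.
  Reading the order statistic as a lifetime gives, at one stroke, its measurability and the
  criterion for it to equal a given \<open>T j\<close>.
\<close>

lemma order_stat_eq_lifetime:
  assumes fin: "finite S" and k: "k \<in> {1..card S}"
  shows "order_stat S T k \<omega> = lifetime S (k_out_of_n S k) T \<omega>"
proof -
  let ?ms = "image_mset (\<lambda>i. T i \<omega>) (mset_set S)"
  let ?xs = "sorted_list_of_multiset ?ms"
  have len: "length ?xs = card S"
    by (metis mset_sorted_list_of_multiset size_image_mset size_mset size_mset_set)
  have "t \<le> order_stat S T k \<omega> \<longleftrightarrow> t \<le> lifetime S (k_out_of_n S k) T \<omega>" for t
  proof -
    have "length (filter (\<lambda>x. t \<le> x) ?xs) = size (filter_mset (\<lambda>x. t \<le> x) ?ms)"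
      by (metis mset_filter mset_sorted_list_of_multiset size_mset)
    also have "\<dots> = card {i\<in>S. t \<le> T i \<omega>}"
      using fin by (simp add: filter_mset_image_mset filter_mset_mset_set)
    finally have count: "length (filter (\<lambda>x. t \<le> x) ?xs) = card {i\<in>S. t \<le> T i \<omega>}" .
    have "k - 1 < length ?xs" using k unfolding len by auto
    then have "t \<le> ?xs ! (k - 1) \<longleftrightarrow> card S - (k - 1) \<le> card {i\<in>S. t \<le> T i \<omega>}"
      using sorted_nth_ge_iff_length_filter[of ?xs "k - 1" t]
      unfolding len count by simp
    also have "\<dots> \<longleftrightarrow> card S - k < card {i\<in>S. t \<le> T i \<omega>}"
      using k by auto
    also have "\<dots> \<longleftrightarrow> t \<le> lifetime S (k_out_of_n S k) T \<omega>"
      unfolding lifetime_ge_iff[OF semicoherent_k_out_of_n[OF fin k] fin]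
      by (simp add: k_out_of_n_def)
    finally show ?thesis unfolding order_stat_def .
  qed
  then show ?thesis by (meson order_antisym order_refl)
qed

lemma order_stat_eq_component_iff:
  assumes fin: "finite S" and k: "k \<in> {1..card S}" and inj: "inj_on (\<lambda>i. T i \<omega>) S"
    and j: "j \<in> S"
  shows "order_stat S T k \<omega> = T j \<omega> \<longleftrightarrow> card (outliving S T j \<omega>) = card S - k"
proof -
  have "finite (outliving S T j \<omega>)" "j \<notin> outliving S T j \<omega>"
    using fin by (auto simp: outliving_def)
  then show ?thesis
    unfolding order_stat_eq_lifetime[OF fin k]
      lifetime_eq_component_iff[where T = T and \<omega> = \<omega>, OF semicoherent_k_out_of_n[OF fin k] fin inj j]
    by (auto simp: k_out_of_n_def)
qed

lemma order_stat_attained: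
  assumes "finite S" "k \<in> {1..card S}"
  obtains j where "j \<in> S" "order_stat S T k \<omega> = T j \<omega>"
proof -
  let ?ms = "image_mset (\<lambda>i. T i \<omega>) (mset_set S)"
  have "length (sorted_list_of_multiset ?ms) = card S"
    by (metis mset_sorted_list_of_multiset size_image_mset size_mset size_mset_set)
  then have "order_stat S T k \<omega> \<in> set (sorted_list_of_multiset ?ms)"
    unfolding order_stat_def using assms by (intro nth_mem) auto
  then show ?thesis using that assms by auto
qed

lemma borel_measurable_lifetime:
  assumes "semicoherent S \<phi>" "finite S" "\<And>i. i \<in> S \<Longrightarrow> T i \<in> borel_measurable P"
  shows "lifetime S \<phi> T \<in> borel_measurable P"
proof -
  have "(\<lambda>\<omega>. Min ((\<lambda>i. T i \<omega>) ` A)) \<in> borel_measurable P" if "A \<subseteq> S" for A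
    using assms that by (intro borel_measurable_Min) (auto intro: finite_subset)
  then have "(\<lambda>\<omega>. Max ((\<lambda>A. Min ((\<lambda>i. T i \<omega>) ` A)) ` {A. A \<subseteq> S \<and> \<phi> A = 1})) \<in> borel_measurable P"
    using assms by (intro borel_measurable_Max) auto
  then show ?thesis by (simp add: lifetime_def[abs_def])
qed

section \<open>Relative quality and the set of outliving components\<close>

lemma max_life_eq_component_iff:
  assumes "j \<in> A"
  shows "max_life A T \<omega> = ereal (T j \<omega>) \<longleftrightarrow> (\<forall>i\<in>A. T i \<omega> \<le> T j \<omega>)"
proof -
  have "ereal (T j \<omega>) \<le> max_life A T \<omega>"
    unfolding max_life_def using assms by (intro SUP_upper)
  then have "max_life A T \<omega> = ereal (T j \<omega>) \<longleftrightarrow> max_life A T \<omega> \<le> ereal (T j \<omega>)"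
    by auto
  also have "\<dots> \<longleftrightarrow> (\<forall>i\<in>A. T i \<omega> \<le> T j \<omega>)"
    unfolding max_life_def by (simp add: SUP_le_iff)
  finally show ?thesis .
qed

lemma max_life_less_iff:
  assumes "finite A"
  shows "max_life A T \<omega> < ereal t \<longleftrightarrow> (\<forall>i\<in>A. T i \<omega> < t)"
  unfolding max_life_def using assms
  by (induction rule: finite_induct) (auto simp: bot_ereal_def)

lemma less_min_life_iff:
  assumes "finite A"
  shows "ereal t < min_life A T \<omega> \<longleftrightarrow> (\<forall>i\<in>A. t < T i \<omega>)"
  unfolding min_life_def using assms
  by (induction rule: finite_induct) (auto simp: top_ereal_def)

text \<open>
  This identity is pointwise and survives ties: a component tied with \<open>j\<close> does not outlive it, and
  it may lie in \<open>S - A\<close>, where the maximum allows equality, but not in \<open>A\<close>.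
\<close>

lemma rel_quality_event_iff:
  assumes "finite S" "j \<in> S" "A \<subseteq> S - {j}"
  shows "max_life (S - A) T \<omega> = ereal (T j \<omega>) \<and> ereal (T j \<omega>) < min_life A T \<omega> \<longleftrightarrow>
    outliving S T j \<omega> = A"
proof -
  have "finite A" "j \<in> S - A" using assms by (auto intro: finite_subset)
  then show ?thesis
    using assms(3)
    by (subst max_life_eq_component_iff) (auto simp: less_min_life_iff outliving_def simp flip: not_less)
qed

lemma rel_quality_eq_outliving:
  assumes "finite S" "j \<in> S" "A \<subseteq> S - {j}"
  shows "rel_quality P T S j A = \<P>(\<omega> in P. outliving S T j \<omega> = A)"
  unfolding rel_quality_def rel_quality_event_iff[OF assms] ..

lemma sets_outliving:
  assumes "finite S" "j \<in> S" "\<And>i. i \<in> S \<Longrightarrow> T i \<in> borel_measurable P"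
  shows "{\<omega>\<in>space P. outliving S T j \<omega> = A} \<in> sets P"
proof (cases "A \<subseteq> S")
  case True
  have [measurable]: "{\<omega>\<in>space P. (T j \<omega> < T i \<omega>) = (i \<in> A)} \<in> sets P" if "i \<in> S" for i
  proof -
    have [measurable]: "T i \<in> borel_measurable P" "T j \<in> borel_measurable P"
      using assms that by auto
    show ?thesis by measurable
  qed
  have "{\<omega>\<in>space P. outliving S T j \<omega> = A} = {\<omega>\<in>space P. \<forall>i\<in>S. (T j \<omega> < T i \<omega>) = (i \<in> A)}"
    using True by (auto simp: outliving_def)
  also have "\<dots> \<in> sets P"
    using assms(1) by (intro sets.sets_Collect_finite_All) auto
  finally show ?thesis .
next
  case False
  then have "{\<omega>\<in>space P. outliving S T j \<omega> = A} = {}" by (auto simp: outliving_def)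
  then show ?thesis by (metis sets.empty_sets)
qed

lemma AE_distinct_lifetimes:
  fixes T :: "'i \<Rightarrow> 'w \<Rightarrow> real"
  assumes "prob_space P" "finite S" "\<And>i. i \<in> S \<Longrightarrow> T i \<in> borel_measurable P"
    and "\<And>i j. i \<in> S \<Longrightarrow> j \<in> S \<Longrightarrow> i \<noteq> j \<Longrightarrow> \<P>(\<omega> in P. T i \<omega> = T j \<omega>) = 0"
  shows "AE \<omega> in P. inj_on (\<lambda>i. T i \<omega>) S"
proof -
  interpret prob_space P by fact
  have "AE \<omega> in P. T i \<omega> \<noteq> T j \<omega>" if "i \<in> S" "j \<in> S" "i \<noteq> j" for i j
  proof -
    have [measurable]: "T i \<in> borel_measurable P" "T j \<in> borel_measurable P"
      using assms that by auto
    have "{\<omega>\<in>space P. T i \<omega> = T j \<omega>} \<in> sets P" by (intro borel_measurable_eq) measurable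
    then show ?thesis using assms(4)[OF that] prob_eq_0 by auto
  qed
  then have "AE \<omega> in P. \<forall>i\<in>S. \<forall>j\<in>S. i \<noteq> j \<longrightarrow> T i \<omega> \<noteq> T j \<omega>"
    using assms(2) by (intro AE_finite_allI) auto
  then show ?thesis by eventually_elim (auto simp: inj_on_def)
qed

section \<open>A system dying at the \<open>k\<close>th failure among selected components\<close>

text \<open>
  For distinct lifetimes only one pair \<open>(j, A)\<close> contributes: the \<open>j\<close> with \<open>T j = T\<^bsub>k:M\<^esub>\<close>, and the
  set \<open>A\<close> of components outliving it. Its contribution is 1 or 0 according to whether the system
  dies with \<open>j\<close>.
\<close>

lemma indicator_lifetime_eq_order_stat:
  fixes \<phi> :: "'i set \<Rightarrow> real"
  assumes sc: "semicoherent S \<phi>" and fin: "finite S" and inj: "inj_on (\<lambda>i. T i \<omega>) S"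
    and M: "M \<subseteq> S" and k: "k \<in> {1..card M}"
  shows "(\<Sum>j\<in>M. \<Sum>A\<in>{A\<in>Pow (S - {j}). card (A \<inter> M) = card M - k}.
      of_bool (outliving S T j \<omega> = A) * (\<phi> (insert j A) - \<phi> A)) =
    of_bool (lifetime S \<phi> T \<omega> = order_stat M T k \<omega>)"
proof -
  have finM: "finite M" and injM: "inj_on (\<lambda>i. T i \<omega>) M"
    using fin M inj by (auto intro: finite_subset inj_on_subset)
  obtain j\<^sub>0 where j\<^sub>0: "j\<^sub>0 \<in> M" "order_stat M T k \<omega> = T j\<^sub>0 \<omega>"
    using order_stat_attained[OF finM k, of T \<omega>] by blast
  let ?U = "\<lambda>j. outliving S T j \<omega>"
  have "(\<Sum>A\<in>{A\<in>Pow (S - {j}). card (A \<inter> M) = card M - k}.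
      of_bool (?U j = A) * (\<phi> (insert j A) - \<phi> A)) =
    (if j = j\<^sub>0 then \<phi> (insert j (?U j)) - \<phi> (?U j) else 0)" (is "sum _ ?\<A> = _") if j: "j \<in> M" for j
  proof -
    have "?U j \<inter> M = outliving M T j \<omega>" using M by (auto simp: outliving_def)
    then have "card (?U j \<inter> M) = card M - k \<longleftrightarrow> T j\<^sub>0 \<omega> = T j \<omega>"
      using order_stat_eq_component_iff[where T = T and \<omega> = \<omega>, OF finM k injM j] j\<^sub>0 by simp
    also have "\<dots> \<longleftrightarrow> j = j\<^sub>0" using injM j j\<^sub>0 by (auto simp: inj_on_def)
    finally have mem: "?U j \<in> ?\<A> \<longleftrightarrow> j = j\<^sub>0" by (auto simp: outliving_def)
    have "(\<Sum>A\<in>?\<A>. of_bool (?U j = A) * (\<phi> (insert j A) - \<phi> A)) =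
        (\<Sum>A\<in>?\<A>. if ?U j = A then \<phi> (insert j A) - \<phi> A else 0)"
      by (intro sum.cong) auto
    also have "\<dots> = (if ?U j \<in> ?\<A> then \<phi> (insert j (?U j)) - \<phi> (?U j) else 0)"
      using fin by (intro sum.delta') auto
    finally show ?thesis unfolding mem .
  qed
  then have "(\<Sum>j\<in>M. \<Sum>A\<in>{A\<in>Pow (S - {j}). card (A \<inter> M) = card M - k}.
      of_bool (?U j = A) * (\<phi> (insert j A) - \<phi> A)) = \<phi> (insert j\<^sub>0 (?U j\<^sub>0)) - \<phi> (?U j\<^sub>0)"
    using j\<^sub>0 finM by simp
  also have "\<dots> = of_bool (lifetime S \<phi> T \<omega> = T j\<^sub>0 \<omega>)"
  proof -
    have sub: "insert j\<^sub>0 (?U j\<^sub>0) \<subseteq> S" "?U j\<^sub>0 \<subseteq> S" and j\<^sub>0S: "j\<^sub>0 \<in> S"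
      using j\<^sub>0 M by (auto simp: outliving_def)
    have "\<phi> (?U j\<^sub>0) \<le> \<phi> (insert j\<^sub>0 (?U j\<^sub>0))"
      using semicoherent_mono[OF sc fin sub(1)] by auto
    then show ?thesis
      unfolding lifetime_eq_component_iff[where T = T and \<omega> = \<omega>, OF sc fin inj j\<^sub>0S]
      using semicoherent_cases[OF sc sub(1)] semicoherent_cases[OF sc sub(2)] by auto
  qed
  finally show ?thesis unfolding j\<^sub>0(2) .
qed

text \<open>
  The expectation of the preceding identity. The set \<open>M\<close> only selects the components whose failures
  are counted, so the whole system (\<open>S = C\<close>) and the module by itself (\<open>S = M\<close>) are both instances.
\<close>

lemma prob_lifetime_eq_order_stat:
  fixes \<phi> :: "'i set \<Rightarrow> real"
  assumes P: "prob_space P" and sc: "semicoherent S \<phi>" and fin: "finite S"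
    and meas: "\<And>i. i \<in> S \<Longrightarrow> T i \<in> borel_measurable P"
    and no_ties: "\<And>i j. i \<in> S \<Longrightarrow> j \<in> S \<Longrightarrow> i \<noteq> j \<Longrightarrow> \<P>(\<omega> in P. T i \<omega> = T j \<omega>) = 0"
    and M: "M \<subseteq> S" and k: "k \<in> {1..card M}"
  shows "\<P>(\<omega> in P. lifetime S \<phi> T \<omega> = order_stat M T k \<omega>) =
    (\<Sum>j\<in>M. \<Sum>A\<in>{A\<in>Pow (S - {j}). card (A \<inter> M) = card M - k}.
      rel_quality P T S j A * (\<phi> (insert j A) - \<phi> A))"
proof -
  interpret prob_space P by fact
  have finM: "finite M" using fin M finite_subset by auto
  have [measurable]: "lifetime S \<phi> T \<in> borel_measurable P"
    using sc fin meas by (rule borel_measurable_lifetime)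
  have "lifetime M (k_out_of_n M k) T \<in> borel_measurable P"
    using semicoherent_k_out_of_n[OF finM k] finM meas M by (intro borel_measurable_lifetime) auto
  also have "lifetime M (k_out_of_n M k) T = order_stat M T k"
    by (intro ext order_stat_eq_lifetime[OF finM k, symmetric])
  finally have [measurable]: "order_stat M T k \<in> borel_measurable P" .
  let ?E = "\<lambda>j A. {\<omega>\<in>space P. outliving S T j \<omega> = A}"
  let ?L = "{\<omega>\<in>space P. lifetime S \<phi> T \<omega> = order_stat M T k \<omega>}"
  have E: "?E j A \<in> events" if "j \<in> M" for j A
    using that M meas fin by (intro sets_outliving) auto
  have L: "?L \<in> events" by (intro borel_measurable_eq) measurable
  have "prob ?L = expectation (\<lambda>\<omega>. indicator ?L \<omega>)"
    using L by simp
  also have "\<dots> = expectation (\<lambda>\<omega>. \<Sum>j\<in>M. \<Sum>A\<in>{A\<in>Pow (S - {j}). card (A \<inter> M) = card M - k}.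
      indicator (?E j A) \<omega> * (\<phi> (insert j A) - \<phi> A))"
  proof (rule integral_cong_AE)
    have distinct: "AE \<omega> in P. inj_on (\<lambda>i. T i \<omega>) S"
      using P fin meas no_ties by (rule AE_distinct_lifetimes)
    show "AE \<omega> in P. indicator ?L \<omega> = (\<Sum>j\<in>M. \<Sum>A\<in>{A\<in>Pow (S - {j}). card (A \<inter> M) = card M - k}.
      indicator (?E j A) \<omega> * (\<phi> (insert j A) - \<phi> A))"
      using distinct AE_space
    proof eventually_elim
      case (elim \<omega>)
      then show ?case
        using indicator_lifetime_eq_order_stat[where T = T and \<omega> = \<omega>, OF sc fin elim(1) M k]
        by (simp add: indicator_def)
    qed
  next
    show "indicator ?L \<in> borel_measurable P"
      using L by (rule borel_measurable_indicator)
    show "(\<lambda>\<omega>. \<Sum>j\<in>M. \<Sum>A\<in>{A\<in>Pow (S - {j}). card (A \<inter> M) = card M - k}.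
      indicator (?E j A) \<omega> * (\<phi> (insert j A) - \<phi> A)) \<in> borel_measurable P"
      by (intro borel_measurable_sum borel_measurable_times borel_measurable_indicator
          borel_measurable_const E)
  qed
  also have "\<dots> = (\<Sum>j\<in>M. \<Sum>A\<in>{A\<in>Pow (S - {j}). card (A \<inter> M) = card M - k}.
      prob (?E j A) * (\<phi> (insert j A) - \<phi> A))"
  proof -
    have int: "integrable P (\<lambda>\<omega>. indicator (?E j A) \<omega> * (\<phi> (insert j A) - \<phi> A))" if "j \<in> M" for j A
      using E[OF that] by (intro integrable_mult_left integrable_real_indicator) (auto simp: less_top[symmetric])
    have "expectation (\<lambda>\<omega>. \<Sum>j\<in>M. \<Sum>A\<in>{A\<in>Pow (S - {j}). card (A \<inter> M) = card M - k}.
        indicator (?E j A) \<omega> * (\<phi> (insert j A) - \<phi> A)) =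
      (\<Sum>j\<in>M. \<Sum>A\<in>{A\<in>Pow (S - {j}). card (A \<inter> M) = card M - k}.
        expectation (\<lambda>\<omega>. indicator (?E j A) \<omega> * (\<phi> (insert j A) - \<phi> A)))"
      by (subst Bochner_Integration.integral_sum, intro Bochner_Integration.integrable_sum int, assumption)
        (intro sum.cong refl Bochner_Integration.integral_sum int)
    also have "\<dots> = (\<Sum>j\<in>M. \<Sum>A\<in>{A\<in>Pow (S - {j}). card (A \<inter> M) = card M - k}.
        prob (?E j A) * (\<phi> (insert j A) - \<phi> A))"
    proof (intro sum.cong refl)
      fix j A assume "j \<in> M"
      then have "integral\<^sup>L P (indicator (?E j A)) = prob (?E j A)"
        using E[of j A] by simp
      then show "expectation (\<lambda>\<omega>. indicator (?E j A) \<omega> * (\<phi> (insert j A) - \<phi> A)) =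
        prob (?E j A) * (\<phi> (insert j A) - \<phi> A)"
        by (simp only: integral_mult_left_zero)
    qed
    finally show ?thesis .
  qed
  also have "\<dots> = (\<Sum>j\<in>M. \<Sum>A\<in>{A\<in>Pow (S - {j}). card (A \<inter> M) = card M - k}.
      rel_quality P T S j A * (\<phi> (insert j A) - \<phi> A))"
    using M fin by (intro sum.cong refl) (auto simp: rel_quality_eq_outliving subset_iff)
  finally show ?thesis .
qed

section \<open>Modules\<close>

text \<open>
  Changing the state of a module component affects the system only through the module, so the
  marginal differences multiply.
\<close>

lemma marginal_difference_factors:
  assumes sm: "system_module C \<phi> M \<chi>\<^sub>M \<psi>" and j: "j \<in> M" and A: "A \<subseteq> M - {j}" and B: "B \<subseteq> C - M"
    and fin: "finite C"
  shows "\<phi> (insert j (A \<union> B)) - \<phi> (A \<union> B) = (\<chi>\<^sub>M (insert j A) - \<chi>\<^sub>M A) * macro_delta \<psi> B"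
proof -
  have M: "M \<subseteq> C" "semicoherent M \<chi>\<^sub>M" "finite M"
    using sm fin by (auto simp: system_module_def intro: finite_subset)
  have eval: "\<phi> (X \<union> B) = \<psi> ((if \<chi>\<^sub>M X = 1 then {None} else {}) \<union> Some ` B)" if "X \<subseteq> M" for X
  proof -
    have "(X \<union> B) \<inter> M = X" "(X \<union> B) - M = B" "X \<union> B \<subseteq> C" using that B M by auto
    then show ?thesis using sm unfolding system_module_def by metis
  qed
  have sub: "insert j A \<subseteq> M" "A \<subseteq> M" using j A by auto
  have "\<chi>\<^sub>M A \<le> \<chi>\<^sub>M (insert j A)" using semicoherent_mono[OF M(2,3) sub(1)] by auto
  then show ?thesis
    using eval[OF sub(1)] eval[OF sub(2)] semicoherent_cases[OF M(2) sub(1)]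
      semicoherent_cases[OF M(2) sub(2)]
    by (auto simp: macro_delta_def)
qed

lemma sum_split_module:
  assumes "j \<in> M" "M \<subseteq> C"
  shows "(\<Sum>X\<in>{X\<in>Pow (C - {j}). card (X \<inter> M) = r}. f X) =
    (\<Sum>A\<in>{A\<in>Pow (M - {j}). card (A \<inter> M) = r}. \<Sum>B\<in>Pow (C - M). f (A \<union> B))"
proof -
  have "(\<Sum>A\<in>{A\<in>Pow (M - {j}). card (A \<inter> M) = r}. \<Sum>B\<in>Pow (C - M). f (A \<union> B)) =
    (\<Sum>(A, B)\<in>{A\<in>Pow (M - {j}). card (A \<inter> M) = r} \<times> Pow (C - M). f (A \<union> B))"
    by (rule sum.cartesian_product)
  also have "\<dots> = (\<Sum>X\<in>{X\<in>Pow (C - {j}). card (X \<inter> M) = r}. f X)"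
  proof (rule sum.reindex_bij_witness[where i = "\<lambda>X. (X \<inter> M, X - M)" and j = "\<lambda>(A, B). A \<union> B"],
      goal_cases)
    case (2 p)
    then obtain A B where p: "p = (A, B)" "A \<subseteq> M - {j}" "card (A \<inter> M) = r" "B \<subseteq> C - M" by auto
    have "(A \<union> B) \<inter> M = A \<inter> M" using p by auto
    then show ?case using p assms by auto
  qed (use assms in \<open>auto simp: Int_assoc\<close>)
  finally show ?thesis by simp
qed

text \<open>
  This deals with the terms of the double sum whose ratio \<open>q\<^sub>j(A \<union> B) / q\<^sub>j\<^sup>M(A)\<close> has denominator 0,
  about which the ratio hypothesis says nothing.
\<close>

lemma rel_quality_module_null:
  assumes P: "prob_space P" and fin: "finite C" and M: "M \<subseteq> C" and j: "j \<in> M"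
    and A: "A \<subseteq> M - {j}" and B: "B \<subseteq> C - M"
    and meas: "\<And>i. i \<in> C \<Longrightarrow> T i \<in> borel_measurable P"
    and null: "rel_quality P T M j A = 0"
  shows "rel_quality P T C j (A \<union> B) = 0"
proof -
  interpret prob_space P by fact
  have finM: "finite M" using fin M finite_subset by auto
  have "A \<union> B \<subseteq> C - {j}" "j \<in> C" using A B M j by auto
  then have "rel_quality P T C j (A \<union> B) = \<P>(\<omega> in P. outliving C T j \<omega> = A \<union> B)"
    using fin by (intro rel_quality_eq_outliving) auto
  also have "\<dots> \<le> \<P>(\<omega> in P. outliving M T j \<omega> = A)"
    \<comment> \<open>the components of \<open>M\<close> that outlive \<open>j\<close> are those of \<open>A \<union> B\<close> lying in \<open>M\<close>\<close>
  proof (rule finite_measure_mono)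
    show "{\<omega>\<in>space P. outliving M T j \<omega> = A} \<in> events"
      using finM j meas M by (intro sets_outliving) auto
    have "outliving M T j \<omega> = A" if "outliving C T j \<omega> = A \<union> B" for \<omega>
    proof -
      have "outliving M T j \<omega> = outliving C T j \<omega> \<inter> M" using M by (auto simp: outliving_def)
      then show ?thesis using that A B by auto
    qed
    then show "{\<omega>\<in>space P. outliving C T j \<omega> = A \<union> B} \<subseteq> {\<omega>\<in>space P. outliving M T j \<omega> = A}"
      by auto
  qed
  also have "\<dots> = 0" using null rel_quality_eq_outliving[OF finM j A, of P T] by simp
  finally show ?thesis unfolding rel_quality_def by (simp add: measure_le_0_iff)
qed

text \<open>
  The conditioning event and the conditional event together say that \<open>A \<union> B\<close> outlives \<open>j\<close> and all
  other components die no later than \<open>j\<close>, with strict inequality outside \<open>M\<close>. The strictness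
  is the only difference to the event of \<open>q\<^sub>j(A \<union> B)\<close>, and it costs a null set.
\<close>

lemma rel_quality_ratio_eq_cond_prob:
  assumes P: "prob_space P" and fin: "finite C" and M: "M \<subseteq> C" and j: "j \<in> M"
    and A: "A \<subseteq> M - {j}" and B: "B \<subseteq> C - M"
    and meas: "\<And>i. i \<in> C \<Longrightarrow> T i \<in> borel_measurable P"
    and no_ties: "\<And>i j. i \<in> C \<Longrightarrow> j \<in> C \<Longrightarrow> i \<noteq> j \<Longrightarrow> \<P>(\<omega> in P. T i \<omega> = T j \<omega>) = 0"
  shows "rel_quality P T C j (A \<union> B) / rel_quality P T M j A =
    \<P>(\<omega> in P. max_life (C - M - B) T \<omega> < ereal (T j \<omega>) \<and> ereal (T j \<omega>) < min_life B T \<omega>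
      \<bar> max_life (M - A) T \<omega> = ereal (T j \<omega>) \<and> ereal (T j \<omega>) < min_life A T \<omega>)"
proof -
  interpret prob_space P by fact
  have finM: "finite M" and finB: "finite B" and AB: "A \<union> B \<subseteq> C - {j}" and jC: "j \<in> C"
    using fin M A B j by (auto intro: finite_subset)
  let ?D = "C - M - B"
  let ?X = "\<lambda>\<omega>. max_life ?D T \<omega> < ereal (T j \<omega>) \<and> ereal (T j \<omega>) < min_life B T \<omega>"
  let ?Y = "\<lambda>\<omega>. max_life (M - A) T \<omega> = ereal (T j \<omega>) \<and> ereal (T j \<omega>) < min_life A T \<omega>"
  have XY: "?X \<omega> \<and> ?Y \<omega> \<longleftrightarrow> outliving C T j \<omega> = A \<union> B \<and> (\<forall>i\<in>?D. T i \<omega> \<noteq> T j \<omega>)" for \<omega>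
  proof -
    have "?X \<omega> \<and> ?Y \<omega> \<longleftrightarrow>
        (\<forall>i\<in>?D. T i \<omega> < T j \<omega>) \<and> (\<forall>i\<in>B. T j \<omega> < T i \<omega>) \<and> outliving M T j \<omega> = A"
      using fin finB by (simp add: max_life_less_iff less_min_life_iff rel_quality_event_iff[OF finM j A])
    also have "\<dots> \<longleftrightarrow> outliving C T j \<omega> = A \<union> B \<and> (\<forall>i\<in>?D. T i \<omega> \<noteq> T j \<omega>)" (is "?l \<longleftrightarrow> ?r")
    proof
      assume l: ?l
      then have inM: "T j \<omega> < T i \<omega> \<longleftrightarrow> i \<in> A" if "i \<in> M" for i
        using that unfolding outliving_def by blast
      have "T j \<omega> < T i \<omega> \<longleftrightarrow> i \<in> A \<union> B" if i: "i \<in> C" for i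
      proof -
        consider "i \<in> M" | "i \<in> B" | "i \<in> ?D" using i by blast
        then show ?thesis
        proof cases
          case 1
          then have "i \<notin> B" using B by blast
          then show ?thesis using inM[OF 1] by simp
        next
          case 2
          then show ?thesis using l by blast
        next
          case 3
          then have "T i \<omega> < T j \<omega>" "i \<notin> A \<union> B" using l A by blast+
          then show ?thesis by simp
        qed
      qed
      then have "outliving C T j \<omega> = A \<union> B"
        using AB unfolding outliving_def by blast
      moreover have "\<forall>i\<in>?D. T i \<omega> \<noteq> T j \<omega>" using l by (metis less_irrefl)
      ultimately show ?r ..
    next
      assume r: ?r
      then have U: "T j \<omega> < T i \<omega> \<longleftrightarrow> i \<in> A \<union> B" if "i \<in> C" for i
        using that unfolding outliving_def by blast
      then have "outliving M T j \<omega> = A" "\<forall>i\<in>B. T j \<omega> < T i \<omega>"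
        using A B M unfolding outliving_def by blast+
      moreover have "T i \<omega> < T j \<omega>" if "i \<in> ?D" for i
      proof -
        have "i \<in> C" "i \<notin> A \<union> B" "T i \<omega> \<noteq> T j \<omega>" using that r A by blast+
        then show ?thesis using U[of i] by simp
      qed
      ultimately show ?l by blast
    qed
    finally show ?thesis .
  qed
  have E: "{\<omega>\<in>space P. outliving C T j \<omega> = A \<union> B} \<in> events"
    using fin jC meas by (rule sets_outliving)
  have "{\<omega>\<in>space P. T i \<omega> \<noteq> T j \<omega>} \<in> events" if "i \<in> ?D" for i
  proof -
    have [measurable]: "T i \<in> borel_measurable P" "T j \<in> borel_measurable P"
      using meas that jC by auto
    show ?thesis by (intro borel_measurable_neq) measurable
  qed
  then have D: "{\<omega>\<in>space P. \<forall>i\<in>?D. T i \<omega> \<noteq> T j \<omega>} \<in> events"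
    using fin by (intro sets.sets_Collect_finite_All) auto
  have "\<P>(\<omega> in P. ?X \<omega> \<and> ?Y \<omega>) = \<P>(\<omega> in P. outliving C T j \<omega> = A \<union> B)"
  proof (rule prob_eq_AE)
    have distinct: "AE \<omega> in P. inj_on (\<lambda>i. T i \<omega>) C"
      using P fin meas no_ties by (rule AE_distinct_lifetimes)
    show "AE \<omega> in P. (?X \<omega> \<and> ?Y \<omega>) \<longleftrightarrow> outliving C T j \<omega> = A \<union> B"
      using distinct
    proof eventually_elim
      case (elim \<omega>)
      have "\<forall>i\<in>?D. T i \<omega> \<noteq> T j \<omega>" using elim j jC by (auto simp: inj_on_def)
      then show ?case unfolding XY by blast
    qed
    show "{\<omega>\<in>space P. ?X \<omega> \<and> ?Y \<omega>} \<in> events"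
      unfolding XY by (intro sets.sets_Collect_conj E D)
  qed (fact E)
  also have "\<dots> = rel_quality P T C j (A \<union> B)"
    by (rule rel_quality_eq_outliving[OF fin jC AB, symmetric])
  finally show ?thesis by (simp add: cond_prob_def rel_quality_def)
qed

theorem theorem15:
  fixes P :: "'w measure"
    and n :: nat
    and C M :: "nat set"
    and T :: "nat \<Rightarrow> 'w \<Rightarrow> real"
    and \<phi> \<chi>\<^sub>M :: "nat set \<Rightarrow> real"
    and \<psi> :: "nat option set \<Rightarrow> real"
    and m :: nat
  assumes "prob_space P"
    and "C = {1..n}"
    and "m = card M"
    and "\<And>i. i \<in> C \<Longrightarrow> T i \<in> borel_measurable P"
    and "\<And>i \<omega>. i \<in> C \<Longrightarrow> \<omega> \<in> space P \<Longrightarrow> 0 \<le> T i \<omega>"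
    and no_ties: "\<And>i j. i \<in> C \<Longrightarrow> j \<in> C \<Longrightarrow> i \<noteq> j \<Longrightarrow> \<P>(\<omega> in P. T i \<omega> = T j \<omega>) = 0"
    and "semicoherent C \<phi>"
    and "system_module C \<phi> M \<chi>\<^sub>M \<psi>"
    and ratio: "\<And>j j' A A' B.
      j \<in> M \<Longrightarrow> j' \<in> M \<Longrightarrow> A \<subseteq> M - {j} \<Longrightarrow> A' \<subseteq> M - {j'} \<Longrightarrow> card A = card A' \<Longrightarrow>
      rel_quality P T M j A \<noteq> 0 \<Longrightarrow> rel_quality P T M j' A' \<noteq> 0 \<Longrightarrow> B \<subseteq> C - M \<Longrightarrow>
      rel_quality P T C j (A \<union> B) / rel_quality P T M j A =
      rel_quality P T C j' (A' \<union> B) / rel_quality P T M j' A'"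
  shows "\<forall>k\<in>{1..m}. \<forall>j\<in>M. \<forall>A. A \<subseteq> M - {j} \<longrightarrow> card A = m - k \<longrightarrow> rel_quality P T M j A \<noteq> 0 \<longrightarrow>
      \<P>(\<omega> in P. lifetime C \<phi> T \<omega> = order_stat M T k \<omega>) =
        \<P>(\<omega> in P. lifetime M \<chi>\<^sub>M T \<omega> = order_stat M T k \<omega>) *
        (\<Sum>B\<in>Pow (C - M). rel_quality P T C j (A \<union> B) / rel_quality P T M j A * macro_delta \<psi> B)
      \<and> (\<forall>B. B \<subseteq> C - M \<longrightarrow>
        rel_quality P T C j (A \<union> B) / rel_quality P T M j A =
        \<P>(\<omega> in P. max_life (C - M - B) T \<omega> < ereal (T j \<omega>) \<and> ereal (T j \<omega>) < min_life B T \<omega>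
          \<bar> max_life (M - A) T \<omega> = ereal (T j \<omega>) \<and> ereal (T j \<omega>) < min_life A T \<omega>))"
proof (intro ballI allI impI conjI)
  have fin: "finite C" and M: "M \<subseteq> C" and scM: "semicoherent M \<chi>\<^sub>M"
    using assms by (auto simp: system_module_def)
  have finM: "finite M" using fin M finite_subset by auto
  fix k j A
  assume k: "k \<in> {1..m}" and j: "j \<in> M" and A: "A \<subseteq> M - {j}" "card A = m - k"
    and q: "rel_quality P T M j A \<noteq> 0"
  show "rel_quality P T C j (A \<union> B) / rel_quality P T M j A =
    \<P>(\<omega> in P. max_life (C - M - B) T \<omega> < ereal (T j \<omega>) \<and> ereal (T j \<omega>) < min_life B T \<omega>
      \<bar> max_life (M - A) T \<omega> = ereal (T j \<omega>) \<and> ereal (T j \<omega>) < min_life A T \<omega>)"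
    if "B \<subseteq> C - M" for B
    using assms(1) fin M j A(1) that assms(4) no_ties by (rule rel_quality_ratio_eq_cond_prob)
  let ?c = "\<Sum>B\<in>Pow (C - M). rel_quality P T C j (A \<union> B) / rel_quality P T M j A * macro_delta \<psi> B"
  have kM: "k \<in> {1..card M}" using k assms(3) by simp
  \<comment> \<open>the ratio hypothesis lets the fixed pair \<open>(j, A)\<close> replace every pair \<open>(i, X)\<close> in the ratio\<close>
  have inner: "(\<Sum>B\<in>Pow (C - M). rel_quality P T C i (X \<union> B) * (\<phi> (insert i (X \<union> B)) - \<phi> (X \<union> B))) =
      rel_quality P T M i X * (\<chi>\<^sub>M (insert i X) - \<chi>\<^sub>M X) * ?c"
    if i: "i \<in> M" and X: "X \<subseteq> M - {i}" "card X = m - k" for i X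
  proof -
    have "rel_quality P T C i (X \<union> B) =
        rel_quality P T M i X * (rel_quality P T C j (A \<union> B) / rel_quality P T M j A)"
      if B: "B \<subseteq> C - M" for B
    proof (cases "rel_quality P T M i X = 0")
      case True
      then show ?thesis
        using rel_quality_module_null[OF assms(1) fin M i X(1) B assms(4)] by simp
    next
      case False
      then show ?thesis
        using ratio[OF i j X(1) A(1) _ False q B] X(2) A(2) by (simp add: divide_eq_eq mult.commute)
    qed
    then show ?thesis
      unfolding sum_distrib_left
      using marginal_difference_factors[OF assms(8) i X(1) _ fin]
      by (intro sum.cong refl) simp
  qed
  have "\<P>(\<omega> in P. lifetime C \<phi> T \<omega> = order_stat M T k \<omega>) =
    (\<Sum>i\<in>M. \<Sum>X\<in>{X\<in>Pow (C - {i}). card (X \<inter> M) = card M - k}.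
      rel_quality P T C i X * (\<phi> (insert i X) - \<phi> X))"
    using assms(1,7) fin assms(4) no_ties M kM by (rule prob_lifetime_eq_order_stat)
  also have "\<dots> = (\<Sum>i\<in>M. \<Sum>X\<in>{X\<in>Pow (M - {i}). card (X \<inter> M) = card M - k}. \<Sum>B\<in>Pow (C - M).
      rel_quality P T C i (X \<union> B) * (\<phi> (insert i (X \<union> B)) - \<phi> (X \<union> B)))"
    using M by (intro sum.cong refl sum_split_module)
  also have "\<dots> = (\<Sum>i\<in>M. \<Sum>X\<in>{X\<in>Pow (M - {i}). card (X \<inter> M) = card M - k}.
      rel_quality P T M i X * (\<chi>\<^sub>M (insert i X) - \<chi>\<^sub>M X) * ?c)"
  proof (intro sum.cong refl inner)
    fix i X assume X: "X \<in> {X\<in>Pow (M - {i}). card (X \<inter> M) = card M - k}"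
    then show "X \<subseteq> M - {i}" by simp
    then have "X \<inter> M = X" by blast
    then show "card X = m - k" using X assms(3) by simp
  qed
  also have "\<dots> = (\<Sum>i\<in>M. \<Sum>X\<in>{X\<in>Pow (M - {i}). card (X \<inter> M) = card M - k}.
      rel_quality P T M i X * (\<chi>\<^sub>M (insert i X) - \<chi>\<^sub>M X)) * ?c"
    by (simp only: sum_distrib_right)
  also have "(\<Sum>i\<in>M. \<Sum>X\<in>{X\<in>Pow (M - {i}). card (X \<inter> M) = card M - k}.
      rel_quality P T M i X * (\<chi>\<^sub>M (insert i X) - \<chi>\<^sub>M X)) =
    \<P>(\<omega> in P. lifetime M \<chi>\<^sub>M T \<omega> = order_stat M T k \<omega>)"
  proof (rule prob_lifetime_eq_order_stat[symmetric, OF assms(1) scM finM _ _ order_refl kM])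
    show "T i \<in> borel_measurable P" if "i \<in> M" for i
      using assms(4) that M by blast
    show "\<P>(\<omega> in P. T i \<omega> = T l \<omega>) = 0" if "i \<in> M" "l \<in> M" "i \<noteq> l" for i l
      using no_ties that M by blast
  qed
  finally show "\<P>(\<omega> in P. lifetime C \<phi> T \<omega> = order_stat M T k \<omega>) =
    \<P>(\<omega> in P. lifetime M \<chi>\<^sub>M T \<omega> = order_stat M T k \<omega>) * ?c" .
qed

end
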